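(* Let $k\ge 2$, let $G$ be a complete $k$-partite graph on $n$ vertices with nonempty parts $V_1,\dots,V_k$, let $K$ be a field, and let $I\subset S=K[x_1,\dots,x_n]$ be the edge ideal of $G$. Then Stanley's conjecture holds for $I$, that is, $$\operatorname{sdepth}(I)\ge \operatorname{depth}(I).$$
   Context: A complete $k$-partite graph is a graph whose finite vertex set $V$ is partitioned into $k$ disjoint subsets $V_1,\dots,V_k$ and whose edge set is $E=\{\{u,v\}: u\in V_i,\ v\in V_j,\ i\ne j\}$. The edge ideal of a graph on vertices $v_1,\dots,v_n$ is the squarefree monomial ideal $(x_ix_j:\{v_i,v_j\}\in E)$ of $S$. The depth of $I$ is the depth of the $S$-module $I$ with respect to the maximal ideal $(x_1,\dots,x_n)$. Stanley depth: let $M$ be a finitely generated $\mathbb{Z}^n$-graded $S$-module. For a homogeneous element $u\in M$ and a subset $Z\subset\{x_1,\dots,x_n\}$, let $uK[Z]$ be the $K$-subspace of $M$ consisting of all elements $uf$ with $f\in K[Z]$. It is called a Stanley space of dimension $|Z|$ if $uK[Z]$ is a free $K[Z]$-module. A Stanley decomposition of $M$ is a presentation of the $K$-vector space $M$ as a finite direct sum of Stanley spaces $\mathcal{D}: M=\bigoplus_{i=1}^r u_iK[Z_i]$. Put $\operatorname{sdepth}(\mathcal{D})=\min\{|Z_i|: i=1,\dots,r\}$ and $\operatorname{sdepth}(M)=\max\{\operatorname{sdepth}(\mathcal{D}):\mathcal{D}\text{ is a Stanley decomposition of }M\}$. Stanley's conjecture for $M$ is the inequality $\operatorname{sdepth}(M)\ge\operatorname{depth}(M)$.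 *)

theory Defs
  imports
    "HOL-Library.Poly_Mapping"
    "HOL-Library.FuncSet"
    "HOL-Library.Disjoint_Sets"
    "HOL-Library.Extended_Nat"
begin

section \<open>Complete multipartite graphs\<close>

text \<open>Graphs are given by a vertex set and a set of two-element edges. Empty parts are not
  excluded here.\<close>

definition complete_multipartite ::
    "'v set \<Rightarrow> 'v set set \<Rightarrow> nat \<Rightarrow> (nat \<Rightarrow> 'v set) \<Rightarrow> bool" where
  "complete_multipartite W E k V \<longleftrightarrow>
     finite W \<and>
     disjoint_family_on V {..<k} \<and>
     (\<Union>i<k. V i) = W \<and>
     E = {{u, v} | u v i j. i < k \<and> j < k \<and> i \<noteq> j \<and> u \<in> V i \<and> v \<in> V j}"


section \<open>Polynomial rings\<close>

text \<open>For a finite type \<open>'v\<close> with \<open>n\<close> elements and a field \<open>'k\<close>, the type \<open>('v, 'k) mpoly\<close> is the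
  polynomial ring over \<open>'k\<close> in the \<open>n\<close> variables \<open>x\<^sub>v\<close>: a polynomial is a finitely supported map
  from exponent vectors to coefficients, and multiplication is convolution.\<close>

type_synonym ('v, 'k) mpoly = "('v \<Rightarrow>\<^sub>0 nat) \<Rightarrow>\<^sub>0 'k"

definition var :: "'v \<Rightarrow> ('v, 'k::comm_ring_1) mpoly" where
  "var v = Poly_Mapping.single (Poly_Mapping.single v 1) 1"

text \<open>The subring \<open>K[Z]\<close> of polynomials in the variables from \<open>Z\<close>.\<close>

definition polys_in :: "'v set \<Rightarrow> ('v, 'k::comm_ring_1) mpoly set" where
  "polys_in Z = {f. \<forall>m \<in> Poly_Mapping.keys f. Poly_Mapping.keys m \<subseteq> Z}"

text \<open>The component of degree \<open>a\<close> of the standard multigrading; it is zero if \<open>a\<close> has a negative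
  entry.\<close>

definition mpoly_component :: "('v \<Rightarrow> int) \<Rightarrow> ('v, 'k::comm_ring_1) mpoly set" where
  "mpoly_component a =
     {f. \<forall>m \<in> Poly_Mapping.keys f. \<forall>v. int (Poly_Mapping.lookup m v) = a v}"

lemma module_mult: "module ((*) :: 'a::comm_ring_1 \<Rightarrow> 'a \<Rightarrow> 'a)"
  by unfold_locales (simp_all add: algebra_simps)

definition ideal_generated :: "'a::comm_ring_1 set \<Rightarrow> 'a set" where
  "ideal_generated B = module.span (*) B"

definition irrelevant_ideal :: "('v, 'k::comm_ring_1) mpoly set" where
  "irrelevant_ideal = ideal_generated (range var)"

definition edge_ideal :: "'v set set \<Rightarrow> ('v, 'k::comm_ring_1) mpoly set" where
  "edge_ideal E = ideal_generated {var u * var v | u v. {u, v} \<in> E}"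


section \<open>Depth\<close>

text \<open>Modules are submodules \<open>M\<close> of an ambient module with scalar multiplication \<open>scale\<close>. For
  ring elements \<open>F\<close>, the following is the submodule \<open>(F)M\<close> of \<open>M\<close>.\<close>

definition ideal_times_module ::
    "('r::comm_ring_1 \<Rightarrow> 'm::ab_group_add \<Rightarrow> 'm) \<Rightarrow> 'r set \<Rightarrow> 'm set \<Rightarrow> 'm set" where
  "ideal_times_module scale F M = module.span scale {scale f u | f u. f \<in> F \<and> u \<in> M}"

text \<open>\<open>f\<^sub>i\<close> is a nonzerodivisor on \<open>M / (f\<^sub>0, \<dots>, f\<^sub>i\<^sub>-\<^sub>1)M\<close> for all \<open>i\<close>, and
  the final quotient is nonzero; the quotients are expressed by representatives.\<close>

definition regular_sequence ::
    "('r::comm_ring_1 \<Rightarrow> 'm::ab_group_add \<Rightarrow> 'm) \<Rightarrow> 'm set \<Rightarrow> 'r list \<Rightarrow> bool" where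
  "regular_sequence scale M fs \<longleftrightarrow>
     (\<forall>i < length fs. \<forall>u \<in> M.
        scale (fs ! i) u \<in> ideal_times_module scale (set (take i fs)) M \<longrightarrow>
        u \<in> ideal_times_module scale (set (take i fs)) M) \<and>
     ideal_times_module scale (set fs) M \<noteq> M"

definition depth ::
    "('r::comm_ring_1 \<Rightarrow> 'm::ab_group_add \<Rightarrow> 'm) \<Rightarrow> 'r set \<Rightarrow> 'm set \<Rightarrow> enat" where
  "depth scale J M =
     Sup {enat (length fs) | fs. set fs \<subseteq> J \<and> regular_sequence scale M fs}"


section \<open>Stanley depth\<close>

definition stanley_space ::
    "(('v, 'k::comm_ring_1) mpoly \<Rightarrow> 'm::ab_group_add \<Rightarrow> 'm) \<Rightarrow> 'm \<Rightarrow> 'v set \<Rightarrow> 'm set" where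
  "stanley_space scale u Z = (\<lambda>f. scale f u) ` polys_in Z"

text \<open>The cyclic module \<open>u K[Z]\<close> is nonzero and free over \<open>K[Z]\<close> iff \<open>u\<close> is a basis of it, that is, iff
  \<open>u\<close> has zero annihilator in \<open>K[Z]\<close>. The zero module is not counted as a Stanley space.\<close>

definition is_stanley_space ::
    "(('v, 'k::comm_ring_1) mpoly \<Rightarrow> 'm::ab_group_add \<Rightarrow> 'm) \<Rightarrow> 'm \<Rightarrow> 'v set \<Rightarrow> bool" where
  "is_stanley_space scale u Z \<longleftrightarrow> (\<forall>f \<in> polys_in Z. scale f u = 0 \<longrightarrow> f = 0)"

text \<open>\<open>M\<close> is the internal direct sum of the subspaces \<open>U\<^sub>i\<close>, \<open>i < r\<close>.\<close>

definition is_direct_sum :: "'m::ab_group_add set \<Rightarrow> nat \<Rightarrow> (nat \<Rightarrow> 'm set) \<Rightarrow> bool" where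
  "is_direct_sum M r U \<longleftrightarrow> bij_betw (\<lambda>x. \<Sum>i<r. x i) (\<Pi>\<^sub>E i\<in>{..<r}. U i) M"

text \<open>Here \<open>gr a\<close> is the component of degree \<open>a\<close> of the ambient module, so that the component of
  the graded submodule \<open>M\<close> is \<open>M \<inter> gr a\<close>. The list consists of the pairs \<open>(u\<^sub>i, Z\<^sub>i)\<close>.\<close>

definition stanley_decomposition ::
    "(('v, 'k::comm_ring_1) mpoly \<Rightarrow> 'm::ab_group_add \<Rightarrow> 'm) \<Rightarrow> (('v \<Rightarrow> int) \<Rightarrow> 'm set) \<Rightarrow>
      'm set \<Rightarrow> ('m \<times> 'v set) list \<Rightarrow> bool" where
  "stanley_decomposition scale gr M D \<longleftrightarrow>
     (\<forall>(u, Z) \<in> set D. (\<exists>a. u \<in> M \<inter> gr a) \<and> is_stanley_space scale u Z) \<and>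
     is_direct_sum M (length D) (\<lambda>i. stanley_space scale (fst (D ! i)) (snd (D ! i)))"

definition sdepth_decomposition :: "('m \<times> 'v set) list \<Rightarrow> nat" where
  "sdepth_decomposition D = Min ((\<lambda>(u, Z). card Z) ` set D)"

definition sdepth ::
    "(('v, 'k::comm_ring_1) mpoly \<Rightarrow> 'm::ab_group_add \<Rightarrow> 'm) \<Rightarrow> (('v \<Rightarrow> int) \<Rightarrow> 'm set) \<Rightarrow>
      'm set \<Rightarrow> nat" where
  "sdepth scale gr M =
     Max {sdepth_decomposition D | D. stanley_decomposition scale gr M D}"

end

theory Submission
  imports Defs
begin

text \<open>Both sides are compared with \<open>2\<close>: the depth of \<open>I\<close> is at most two, the Stanley depth at least two.

  The Stanley depth bound holds for every nonzero edge ideal. A monomial lies in \<open>I\<close> iff its support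
  contains an edge, so \<open>I\<close> is the direct sum of the spaces \<open>x\<^sub>A K[A]\<close>, where \<open>A\<close> ranges over the vertex
  sets that contain an edge and \<open>x\<^sub>A\<close> is the product of the variables in \<open>A\<close>
  (\<open>sdepth_edge_ideal_ge\<close>).

  For the depth, note that a set of vertices without an edge is contained in a single part. Hence
  \<open>I\<close> is the intersection of the primes \<open>P\<^sub>i\<close> generated by the variables outside \<open>V\<^sub>i\<close>, and the
  primes \<open>P\<^sub>i\<close> and \<open>P\<^sub>j\<close> add up to the irrelevant ideal for \<open>i \<noteq> j\<close>. Geometrically, the
  coordinate subspaces cut out by the \<open>P\<^sub>i\<close> meet only in the origin, so \<open>S/I\<close> has depth one and
  \<open>I\<close> has depth two. The element of \<open>\<Prod>\<^sub>i S/P\<^sub>i\<close> that is \<open>1\<close> at \<open>i = 0\<close> and \<open>0\<close> elsewhere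
  is not in \<open>S/I\<close>, but the irrelevant ideal multiplies it into \<open>S/I\<close>. The proof makes the resulting
  obstruction to a regular sequence \<open>f, g, h\<close> explicit. Write \<open>\<rho>\<close> for the homomorphism that sets the
  variables outside \<open>V\<^sub>0\<close> to zero; then \<open>u = f \<rho>(g) - g \<rho>(f)\<close> lies in \<open>I\<close>
  (\<open>commutator_mem_edge_ideal\<close>) and
    \<open>h u = f (h \<rho>(g) - g \<rho>(h)) - g (h \<rho>(f) - f \<rho>(h))\<close>
  lies in \<open>(f, g) I\<close>. Regularity of \<open>h\<close> yields \<open>u \<in> (f, g) I\<close>, which says that \<open>\<rho>(f) + b\<close> and
  \<open>\<rho>(g) - a\<close>, with \<open>a, b \<in> I\<close>, are proportional to \<open>f\<close> and \<open>g\<close>. As \<open>f\<close> and \<open>g\<close> do not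
  both vanish on a coordinate hyperplane or on any of the subspaces above
  (\<open>regular_pair_not_in_kernel\<close>), the factor is a polynomial \<open>r\<close> that restricts to \<open>1\<close> on the subspace of \<open>V\<^sub>0\<close> and to \<open>0\<close> on that of
  \<open>V\<^sub>1\<close>. This is absurd at the origin (\<open>no_regular_triple\<close>).\<close>

section \<open>Monomials and the absence of zero divisors\<close>

text \<open>Polynomials and exponent vectors are both finitely supported maps; separate names for the same
  operations keep the two levels apart.\<close>

abbreviation monomials :: "('a \<Rightarrow>\<^sub>0 'b::zero) \<Rightarrow> 'a set" where
  "monomials \<equiv> Poly_Mapping.keys"

abbreviation support :: "('v \<Rightarrow>\<^sub>0 nat) \<Rightarrow> 'v set" where
  "support \<equiv> Poly_Mapping.keys"

abbreviation coefficient :: "('a \<Rightarrow>\<^sub>0 'b::zero) \<Rightarrow> 'a \<Rightarrow> 'b" where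
  "coefficient \<equiv> Poly_Mapping.lookup"

abbreviation monom :: "'a \<Rightarrow> 'b::zero \<Rightarrow> 'a \<Rightarrow>\<^sub>0 'b" where
  "monom \<equiv> Poly_Mapping.single"

lemma support_add: "support (a + b) = support a \<union> support b"
  by (auto simp: in_keys_iff lookup_add)

lemma monomials_mult_cases:
  assumes "m \<in> monomials (f * g)"
  obtains a b where "a \<in> monomials f" "b \<in> monomials g" "m = a + b"
  using keys_mult[of f g] assms by blast

lemma sum_of_terms: "(\<Sum>m\<in>monomials f. monom m (coefficient f m)) = f"
proof (rule poly_mapping_eqI)
  fix m
  show "coefficient (\<Sum>m\<in>monomials f. monom m (coefficient f m)) m = coefficient f m"
    by (simp add: lookup_sum lookup_single when_def in_keys_iff)
qed

lemma monomial_factor: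
  fixes f :: "('v, 'k::comm_ring_1) mpoly"
  assumes "\<And>m. m \<in> monomials f \<Longrightarrow> \<exists>m'. m = e + m'"
  obtains q where "f = monom e 1 * q" "\<And>m. m \<in> monomials q \<Longrightarrow> e + m \<in> monomials f"
proof
  let ?q = "\<Sum>m\<in>monomials f. monom (m - e) (coefficient f m)"
  have e: "e + (m - e) = m" if "m \<in> monomials f" for m
    using assms[OF that] by auto
  have "f = (\<Sum>m\<in>monomials f. monom m (coefficient f m))"
    by (simp add: sum_of_terms)
  also have "\<dots> = monom e 1 * ?q"
    by (auto simp: sum_distrib_left mult_single e intro!: sum.cong)
  finally show "f = monom e 1 * ?q" .
  show "e + m \<in> monomials f" if "m \<in> monomials ?q" for m
    using keys_sum[of "\<lambda>m. monom (m - e) (coefficient f m)" "monomials f"] that e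
    by (auto split: if_splits)
qed

text \<open>The leading coefficients multiply: the product of the two leading monomials cannot be obtained
  from any other pair of monomials. The linear order is pulled back along \<open>\<phi>\<close>, so that the index
  type of the variables needs no order of its own.\<close>

lemma product_nonzero_of_order_embedding:
  fixes f g :: "'a::monoid_add \<Rightarrow>\<^sub>0 'b::{ring_1, semiring_no_zero_divisors}"
    and \<phi> :: "'a \<Rightarrow> 'c::{ordered_cancel_comm_monoid_add, linorder}"
  assumes "inj \<phi>" and add: "\<And>a b. \<phi> (a + b) = \<phi> a + \<phi> b" and "f \<noteq> 0" "g \<noteq> 0"
  shows "f * g \<noteq> 0"
proof -
  have lead: "\<exists>a c r. h = monom a c + r \<and> c \<noteq> 0 \<and> (\<forall>b\<in>monomials h. \<phi> b \<le> \<phi> a) \<and>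
      (\<forall>b\<in>monomials r. \<phi> b < \<phi> a)" if "h \<noteq> 0" for h :: "'a \<Rightarrow>\<^sub>0 'b"
  proof -
    have "finite (\<phi> ` monomials h)" "\<phi> ` monomials h \<noteq> {}"
      using that by auto
    then obtain a where a: "a \<in> monomials h" "\<forall>b\<in>monomials h. \<phi> b \<le> \<phi> a"
      by (smt (verit, ccfv_threshold) Max_ge Max_in imageE image_eqI)
    let ?r = "h - monom a (coefficient h a)"
    have "\<phi> b < \<phi> a" if "b \<in> monomials ?r" for b
    proof -
      have "b \<noteq> a" "b \<in> monomials h"
        using that a(1) by (auto simp: in_keys_iff lookup_minus lookup_single when_def split: if_splits)
      then show ?thesis
        using a(2) \<open>inj \<phi>\<close> by (metis injD order_le_less)
    qed
    moreover have "h = monom a (coefficient h a) + ?r"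
      by simp
    ultimately show ?thesis
      using a by (metis in_keys_iff)
  qed
  obtain a c r where f: "f = monom a c + r" "c \<noteq> 0" "\<forall>b\<in>monomials r. \<phi> b < \<phi> a"
    using lead[OF \<open>f \<noteq> 0\<close>] by blast
  obtain b d s where g: "g = monom b d + s" "d \<noteq> 0" "\<forall>x\<in>monomials g. \<phi> x \<le> \<phi> b"
      "\<forall>x\<in>monomials s. \<phi> x < \<phi> b"
    using lead[OF \<open>g \<noteq> 0\<close>] by blast
  have "f * g = monom (a + b) (c * d) + monom a c * s + r * g"
    by (simp add: f(1) g(1) algebra_simps mult_single)
  moreover have "a + b \<notin> monomials (monom a c * s)"
  proof
    assume "a + b \<in> monomials (monom a c * s)"
    then obtain x where "x \<in> monomials s" "a + b = a + x"
      by (auto elim!: monomials_mult_cases split: if_splits)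
    then show False
      using g(4) add by (metis add_strict_left_mono order_less_irrefl)
  qed
  moreover have "a + b \<notin> monomials (r * g)"
  proof
    assume "a + b \<in> monomials (r * g)"
    then obtain x y where "x \<in> monomials r" "y \<in> monomials g" "a + b = x + y"
      by (auto elim!: monomials_mult_cases)
    then show False
      using f(3) g(3) add by (metis add_less_le_mono order_less_irrefl)
  qed
  ultimately have "coefficient (f * g) (a + b) = c * d"
    by (simp add: lookup_add in_keys_iff)
  then show ?thesis
    using f(2) g(2) by auto
qed

text \<open>Numbering the variables embeds the exponent vectors into \<open>nat \<Rightarrow>\<^sub>0 nat\<close>, which carries a
  linear order compatible with addition.\<close>

lemma mpoly_mult_eq_0_iff:
  fixes f g :: "('v::finite, 'k::field) mpoly"
  shows "f * g = 0 \<longleftrightarrow> f = 0 \<or> g = 0"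
proof -
  have "finite (UNIV :: 'v set)" by simp
  then obtain e :: "'v \<Rightarrow> nat" where e: "inj e"
    using finite_imp_inj_to_nat_seg by blast
  define \<phi> :: "('v \<Rightarrow>\<^sub>0 nat) \<Rightarrow> (nat \<Rightarrow>\<^sub>0 nat)" where
    "\<phi> m = (\<Sum>v\<in>UNIV. monom (e v) (coefficient m v))" for m
  have "coefficient (\<phi> m) (e v) = coefficient m v" for m v
    using e by (simp add: \<phi>_def lookup_sum lookup_single when_def inj_eq)
  then have "inj \<phi>"
    by (metis injI poly_mapping_eqI)
  moreover have "\<phi> (a + b) = \<phi> a + \<phi> b" for a b
    by (simp add: \<phi>_def lookup_add single_add sum.distrib)
  ultimately show ?thesis
    using product_nonzero_of_order_embedding[of \<phi> f g] by auto
qed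

lemma mpoly_mult_left_cancel:
  fixes f g h :: "('v::finite, 'k::field) mpoly"
  shows "f \<noteq> 0 \<Longrightarrow> f * g = f * h \<longleftrightarrow> g = h"
  using mpoly_mult_eq_0_iff[of f "g - h"] by (auto simp: algebra_simps)

section \<open>Setting variables to zero\<close>

lift_definition restrict_monomials :: "('a \<Rightarrow> bool) \<Rightarrow> ('a \<Rightarrow>\<^sub>0 'b::zero) \<Rightarrow> 'a \<Rightarrow>\<^sub>0 'b"
  is "\<lambda>P f m. f m when P m"
  by (erule rev_finite_subset) auto

lemma lookup_restrict_monomials [simp]:
  "coefficient (restrict_monomials P f) m = (if P m then coefficient f m else 0)"
  by transfer (simp add: when_def)

lemma monomials_restrict_monomials [simp]:
  "monomials (restrict_monomials P f) = {m \<in> monomials f. P m}"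
  by (auto simp: in_keys_iff split: if_splits)

lemma restrict_monomials_add: "restrict_monomials P (f + g) = restrict_monomials P f + restrict_monomials P g"
  by (rule poly_mapping_eqI) (simp add: lookup_add)

lemma restrict_monomials_diff:
  fixes f g :: "'a \<Rightarrow>\<^sub>0 'b::ab_group_add"
  shows "restrict_monomials P (f - g) = restrict_monomials P f - restrict_monomials P g"
  by (rule poly_mapping_eqI) (simp add: lookup_minus)

lemma restrict_monomials_eq_0_iff: "restrict_monomials P f = 0 \<longleftrightarrow> (\<forall>m\<in>monomials f. \<not> P m)"
  by (auto simp flip: keys_eq_empty)

lemma restrict_monomials_eq_self: "(\<And>m. m \<in> monomials f \<Longrightarrow> P m) \<Longrightarrow> restrict_monomials P f = f"
  by (rule poly_mapping_eqI) (auto simp: in_keys_iff)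

text \<open>The condition on \<open>P\<close> says that the remaining monomials are closed under products and that the
  excluded ones absorb every factor. The excluded terms therefore span an ideal, with a complement
  that is closed under multiplication.\<close>

lemma restrict_monomials_mult:
  fixes f g :: "'a::monoid_add \<Rightarrow>\<^sub>0 'b::ring_1"
  assumes P: "\<And>a b. P (a + b) \<longleftrightarrow> P a \<and> P b"
  shows "restrict_monomials P (f * g) = restrict_monomials P f * restrict_monomials P g"
proof -
  let ?f = "restrict_monomials P f" and ?g = "restrict_monomials P g"
  have "\<not> P m" if "m \<in> monomials (f - restrict_monomials P f)" for f :: "'a \<Rightarrow>\<^sub>0 'b" and m
  proof
    assume "P m"
    then show False
      using that by (simp add: in_keys_iff lookup_minus)
  qed
  then have "restrict_monomials P ((f - ?f) * g) = 0" "restrict_monomials P (?f * (g - ?g)) = 0"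
    using P by (auto simp: restrict_monomials_eq_0_iff elim!: monomials_mult_cases)
  moreover have "restrict_monomials P (?f * ?g) = ?f * ?g"
    using P by (intro restrict_monomials_eq_self) (auto elim!: monomials_mult_cases)
  moreover have "f * g = (f - ?f) * g + ?f * (g - ?g) + ?f * ?g"
    by (simp add: algebra_simps)
  ultimately show ?thesis
    by (metis restrict_monomials_add add_0)
qed

text \<open>This is the substitution \<open>x\<^sub>v \<mapsto> 0\<close> for \<open>v \<notin> A\<close>, which erases exactly the terms in which such a
  variable occurs. Its kernel is the prime ideal generated by the variables outside \<open>A\<close>.\<close>

definition specialize :: "'v set \<Rightarrow> ('v, 'k::comm_ring_1) mpoly \<Rightarrow> ('v, 'k) mpoly" where
  "specialize A = restrict_monomials (\<lambda>m. support m \<subseteq> A)"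

lemma specialize_mult: "specialize A (f * g) = specialize A f * specialize A g"
  unfolding specialize_def by (rule restrict_monomials_mult) (auto simp: support_add)

lemma specialize_add: "specialize A (f + g) = specialize A f + specialize A g"
  unfolding specialize_def by (rule restrict_monomials_add)

lemma specialize_diff: "specialize A (f - g) = specialize A f - specialize A g"
  unfolding specialize_def by (rule restrict_monomials_diff)

lemma specialize_specialize: "specialize A (specialize B f) = specialize (A \<inter> B) f"
  unfolding specialize_def by (rule poly_mapping_eqI) auto

lemma specialize_eq_0_iff: "specialize A f = 0 \<longleftrightarrow> (\<forall>m\<in>monomials f. \<not> support m \<subseteq> A)"
  unfolding specialize_def by (rule restrict_monomials_eq_0_iff)

lemma specialize_0 [simp]: "specialize A 0 = 0"
  by (simp add: specialize_eq_0_iff)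

section \<open>Edge ideals and products of ideals\<close>

lemma subspace_ideal_generated: "module.subspace (*) (ideal_generated B)"
  unfolding ideal_generated_def by (rule module.subspace_span[OF module_mult])

lemma subspace_monomials:
  fixes U :: "('v \<Rightarrow>\<^sub>0 nat) set"
  assumes "\<And>a b. b \<in> U \<Longrightarrow> a + b \<in> U"
  shows "module.subspace (*) {f :: ('v, 'k::comm_ring_1) mpoly. monomials f \<subseteq> U}"
proof (rule module.subspaceI[OF module_mult]; clarsimp)
  fix f g :: "('v, 'k) mpoly" and m
  show "m \<in> U" if "monomials f \<subseteq> U" "monomials g \<subseteq> U" "m \<in> monomials (f + g)"
    using that keys_add[of f g] by blast
  show "m \<in> U" if "monomials g \<subseteq> U" "m \<in> monomials (f * g)"
    using that assms by (auto elim!: monomials_mult_cases)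
qed

lemma monom_factor_vars:
  assumes "u \<noteq> v" "u \<in> support m" "v \<in> support m"
  shows "\<exists>m'. m = (monom u 1 + monom v 1) + m'"
proof
  show "m = (monom u 1 + monom v 1) + (m - (monom u 1 + monom v 1))"
    using assms by (intro poly_mapping_eqI) (auto simp: lookup_add lookup_minus lookup_single when_def in_keys_iff)
qed

lemma mem_edge_ideal_iff:
  fixes f :: "('v, 'k::comm_ring_1) mpoly"
  assumes loopless: "\<And>v. {v} \<notin> E"
  shows "f \<in> edge_ideal E \<longleftrightarrow>
    (\<forall>m\<in>monomials f. \<exists>u v. {u, v} \<in> E \<and> u \<in> support m \<and> v \<in> support m)"
proof
  let ?U = "{m. \<exists>u v. {u, v} \<in> E \<and> u \<in> support m \<and> v \<in> support m}"
  let ?B = "{var u * var v | u v. {u, v} \<in> E} :: ('v, 'k) mpoly set"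
  have "module.span (*) ?B \<subseteq> {f. monomials f \<subseteq> ?U}"
    by (intro module.span_minimal[OF module_mult] subspace_monomials)
      (auto simp: var_def mult_single support_add split: if_splits, blast)
  then show "f \<in> edge_ideal E \<Longrightarrow> \<forall>m\<in>monomials f. \<exists>u v. {u, v} \<in> E \<and> u \<in> support m \<and> v \<in> support m"
    unfolding edge_ideal_def ideal_generated_def by blast
  assume f: "\<forall>m\<in>monomials f. \<exists>u v. {u, v} \<in> E \<and> u \<in> support m \<and> v \<in> support m"
  have "monom m (coefficient f m) \<in> module.span (*) ?B" if m: "m \<in> monomials f" for m
  proof -
    obtain u v where uv: "{u, v} \<in> E" "u \<in> support m" "v \<in> support m"
      using bspec[OF f m] by blast
    then obtain m' where "m = (monom u 1 + monom v 1) + m'"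
      using monom_factor_vars loopless by (metis insert_absorb2)
    then have factor: "monom m (coefficient f m) = monom m' (coefficient f m) * (var u * var v)"
      by (simp add: var_def mult_single add_ac)
    have "var u * var v \<in> ?B"
      using uv by blast
    then show ?thesis
      unfolding factor by (intro module.span_scale[OF module_mult] module.span_base[OF module_mult])
  qed
  then have "(\<Sum>m\<in>monomials f. monom m (coefficient f m)) \<in> module.span (*) ?B"
    by (intro module.span_sum[OF module_mult])
  then show "f \<in> edge_ideal E"
    by (simp add: edge_ideal_def ideal_generated_def sum_of_terms)
qed

lemma specialize_irrelevant:
  assumes "f \<in> irrelevant_ideal"
  shows "specialize {} f = 0"
proof -
  have "irrelevant_ideal \<subseteq> {f. monomials f \<subseteq> {m. \<exists>v. v \<in> support m}}"
    unfolding irrelevant_ideal_def ideal_generated_def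
    by (intro module.span_minimal[OF module_mult] subspace_monomials)
      (auto simp: var_def support_add split: if_splits)
  then have "\<forall>m\<in>monomials f. \<exists>v. v \<in> support m"
    using assms by blast
  then show ?thesis
    unfolding specialize_eq_0_iff by blast
qed

lemma ideal_times_module_empty: "ideal_times_module (*) {} I = {0 :: 'r::comm_ring_1}"
  unfolding ideal_times_module_def by (simp add: module.span_empty[OF module_mult])

text \<open>Since \<open>f I\<close> is already a submodule, no linear combinations of its elements are needed. Iterating
  this rule turns membership in \<open>(f, g) I\<close> into the existence of two coefficients in \<open>I\<close>.\<close>

lemma ideal_times_module_insert:
  fixes I :: "'r::comm_ring_1 set"
  assumes "module.subspace (*) I"
  shows "ideal_times_module (*) (insert f F) I =
    {f * c + y | c y. c \<in> I \<and> y \<in> ideal_times_module (*) F I}"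
proof -
  interpret module "(*) :: 'r \<Rightarrow> 'r \<Rightarrow> 'r" by (rule module_mult)
  have "subspace ((\<lambda>c. f * c) ` I)"
  proof (rule subspaceI)
    show "0 \<in> (*) f ` I"
      using subspace_0[OF assms] by (metis image_eqI mult_zero_right)
    show "x + y \<in> (*) f ` I" if "x \<in> (*) f ` I" "y \<in> (*) f ` I" for x y
      using that subspace_add[OF assms] by (auto simp flip: distrib_left)
    show "c * x \<in> (*) f ` I" if x: "x \<in> (*) f ` I" for c x
    proof -
      obtain y where "y \<in> I" "x = f * y" using x by blast
      then have "c * y \<in> I" "c * x = f * (c * y)"
        using subspace_scale[OF assms] by (simp_all add: mult.left_commute)
      then show ?thesis by blast
    qed
  qed
  then have span_f: "span ((\<lambda>c. f * c) ` I) = (\<lambda>c. f * c) ` I"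
    by (simp add: span_eq_iff)
  have split: "{h * u | h u. h \<in> insert f F \<and> u \<in> I} = (\<lambda>c. f * c) ` I \<union> {h * u | h u. h \<in> F \<and> u \<in> I}"
    by blast
  show ?thesis
    unfolding ideal_times_module_def split span_Un span_f by blast
qed


section \<open>No regular sequence of length three\<close>

text \<open>By \<open>adjacent\<close>, the variable \<open>x\<^sub>p\<close> multiplies the kernel of the specialization into \<open>I\<close>. If both
  \<open>f\<close> and \<open>g\<close> were in that kernel, then \<open>g (x\<^sub>p f) = f (x\<^sub>p g)\<close> and regularity would give
  \<open>x\<^sub>p f \<in> f I\<close>, hence \<open>x\<^sub>p \<in> I\<close>, although \<open>I\<close> is generated in degree two.

  The lemma is applied to two kinds of sets: for \<open>A = V\<^sub>i\<close> and \<open>p \<in> V\<^sub>i\<close> it says that \<open>f\<close> and \<open>g\<close>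
  do not both lie in \<open>P\<^sub>i\<close>, and for \<open>A = - {q}\<close> with a neighbour \<open>q\<close> of \<open>p\<close> it says that \<open>x\<^sub>q\<close> is not
  a common factor of \<open>f\<close> and \<open>g\<close>.\<close>

lemma regular_pair_not_in_kernel:
  fixes f g :: "('v::finite, 'k::field) mpoly"
  assumes loopless: "\<And>v. {v} \<notin> E"
    and regular: "\<And>u c. \<lbrakk>u \<in> edge_ideal E; c \<in> edge_ideal E; g * u = f * c\<rbrakk> \<Longrightarrow>
      \<exists>d\<in>edge_ideal E. u = f * d"
    and "f \<noteq> 0" and adjacent: "\<And>j. j \<notin> A \<Longrightarrow> {p, j} \<in> E"
  shows "specialize A f \<noteq> 0 \<or> specialize A g \<noteq> 0"
proof (rule ccontr)
  have mult_p: "var p * y \<in> edge_ideal E" if y: "specialize A y = 0" for y :: "('v, 'k) mpoly"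
    unfolding mem_edge_ideal_iff[OF loopless]
  proof
    fix m assume "m \<in> monomials (var p * y)"
    then obtain b where "b \<in> monomials y" and m: "m = monom p 1 + b"
      by (auto simp: var_def elim!: monomials_mult_cases)
    then obtain j where "j \<in> support b" "j \<notin> A"
      using y by (auto simp: specialize_eq_0_iff)
    then show "\<exists>u v. {u, v} \<in> E \<and> u \<in> support m \<and> v \<in> support m"
      using adjacent[of j] by (auto simp: m support_add)
  qed
  assume "\<not> ?thesis"
  then have "var p * f \<in> edge_ideal E" "var p * g \<in> edge_ideal E"
    by (simp_all add: mult_p)
  then obtain d where d: "d \<in> edge_ideal E" "var p * f = f * d"
    using regular[of "var p * f" "var p * g"] by (auto simp: mult_ac)
  then have "f * var p = f * d"
    by (simp add: mult.commute)
  then have "var p = d"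
    using \<open>f \<noteq> 0\<close> mpoly_mult_left_cancel by blast
  then have "(var p :: ('v, 'k) mpoly) \<in> edge_ideal E"
    using d by simp
  then have "\<exists>u v. {u, v} \<in> E \<and> u \<in> support (monom p 1) \<and> v \<in> support (monom p 1)"
    using bspec[of "monomials (var p :: ('v, 'k) mpoly)" _ "monom p 1"]
    unfolding mem_edge_ideal_iff[OF loopless] by (simp add: var_def)
  then show False
    using loopless by (auto split: if_splits)
qed

lemma complete_multipartite_loopless:
  assumes "complete_multipartite W E k V"
  shows "{v} \<notin> E"
proof
  assume "{v} \<in> E"
  then obtain i j where "i < k" "j < k" "i \<noteq> j" "v \<in> V i" "v \<in> V j"
    using assms unfolding complete_multipartite_def by auto
  then show False
    using assms unfolding complete_multipartite_def disjoint_family_on_def by blast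
qed

lemma complete_multipartite_edge_iff:
  assumes "complete_multipartite UNIV E k V" "i < k" "u \<in> V i"
  shows "{u, v} \<in> E \<longleftrightarrow> v \<notin> V i"
proof -
  obtain j where j: "j < k" "v \<in> V j"
    using assms unfolding complete_multipartite_def by (metis UN_E UNIV_I lessThan_iff)
  have part_unique: "a = b" if "a < k" "b < k" "x \<in> V a" "x \<in> V b" for a b x
    using assms that unfolding complete_multipartite_def disjoint_family_on_def by blast
  show ?thesis
  proof
    assume "{u, v} \<in> E"
    then obtain x y a b where "a < k" "b < k" "a \<noteq> b" "x \<in> V a" "y \<in> V b" "{u, v} = {x, y}"
      using assms unfolding complete_multipartite_def by blast
    then show "v \<notin> V i"
      using part_unique assms(2,3) by (metis doubleton_eq_iff)
  next
    assume "v \<notin> V i"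
    then have "i \<noteq> j"
      using j by auto
    then show "{u, v} \<in> E"
      using assms j unfolding complete_multipartite_def by blast
  qed
qed

text \<open>The decomposition of \<open>I\<close> as the intersection of the primes \<open>P\<^sub>i\<close>: the maximal independent sets
  of the graph are its parts.\<close>

lemma mem_edge_ideal_complete_multipartite_iff:
  fixes f :: "('v::finite, 'k::comm_ring_1) mpoly"
  assumes G: "complete_multipartite UNIV E k V" and "k > 0"
  shows "f \<in> edge_ideal E \<longleftrightarrow> (\<forall>i<k. specialize (V i) f = 0)"
proof -
  have cover: "\<exists>i<k. v \<in> V i" for v
    using G unfolding complete_multipartite_def by blast
  have "(\<exists>u v. {u, v} \<in> E \<and> u \<in> support m \<and> v \<in> support m) \<longleftrightarrow> (\<forall>i<k. \<not> support m \<subseteq> V i)" for m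
  proof (cases "support m = {}")
    case True
    then show ?thesis using \<open>k > 0\<close> by blast
  next
    case False
    then obtain u where u: "u \<in> support m" by blast
    then obtain i where i: "i < k" "u \<in> V i" using cover by blast
    show ?thesis
    proof
      assume "\<exists>u v. {u, v} \<in> E \<and> u \<in> support m \<and> v \<in> support m"
      then show "\<forall>i<k. \<not> support m \<subseteq> V i"
        using complete_multipartite_edge_iff[OF G] by blast
    next
      assume "\<forall>i<k. \<not> support m \<subseteq> V i"
      then obtain v where "v \<in> support m" "v \<notin> V i" using i by blast
      then show "\<exists>u v. {u, v} \<in> E \<and> u \<in> support m \<and> v \<in> support m"
        using complete_multipartite_edge_iff[OF G i] u by blast
    qed
  qed
  then show ?thesis
    unfolding mem_edge_ideal_iff[OF complete_multipartite_loopless[OF G]] specialize_eq_0_iff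
    by blast
qed

text \<open>Modulo \<open>P\<^sub>i\<close> the specialization is the identity, so the two products agree. Modulo \<open>P\<^sub>j\<close> with
  \<open>j \<noteq> i\<close> both specialized factors become constants, and these vanish since \<open>f\<close> and \<open>g\<close> have no
  constant term.\<close>

lemma commutator_mem_edge_ideal:
  fixes f g :: "('v::finite, 'k::comm_ring_1) mpoly"
  assumes G: "complete_multipartite UNIV E k V" and "i < k"
    and f: "f \<in> irrelevant_ideal" and g: "g \<in> irrelevant_ideal"
  shows "f * specialize (V i) g - g * specialize (V i) f \<in> edge_ideal E"
proof -
  have "specialize (V j) (f * specialize (V i) g - g * specialize (V i) f) = 0" if "j < k" for j
  proof (cases "j = i")
    case True
    then show ?thesis
      by (simp add: specialize_diff specialize_mult specialize_specialize)
  next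
    case False
    then have "V j \<inter> V i = {}"
      using G \<open>i < k\<close> \<open>j < k\<close> unfolding complete_multipartite_def disjoint_family_on_def by blast
    then show ?thesis
      by (simp add: specialize_diff specialize_mult specialize_specialize
          specialize_irrelevant[OF f] specialize_irrelevant[OF g])
  qed
  then show ?thesis
    using mem_edge_ideal_complete_multipartite_iff[OF G] \<open>i < k\<close> by auto
qed

text \<open>The hypotheses \<open>f_regular\<close>, \<open>g_regular\<close> and \<open>h_regular\<close> are regularity of \<open>f, g, h\<close> on \<open>I\<close>,
  with membership in \<open>f I\<close> and \<open>(f, g) I\<close> spelled out.\<close>

lemma no_regular_triple:
  fixes f g h :: "('v::finite, 'k::field) mpoly"
  assumes G: "complete_multipartite UNIV E k V" and "k \<ge> 2" and nonempty: "\<forall>i<k. V i \<noteq> {}"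
    and I: "I = edge_ideal E"
    and irrelevant: "f \<in> irrelevant_ideal" "g \<in> irrelevant_ideal" "h \<in> irrelevant_ideal"
    and f_regular: "\<And>u. \<lbrakk>u \<in> I; f * u = 0\<rbrakk> \<Longrightarrow> u = 0"
    and g_regular: "\<And>u c. \<lbrakk>u \<in> I; c \<in> I; g * u = f * c\<rbrakk> \<Longrightarrow> \<exists>d\<in>I. u = f * d"
    and h_regular: "\<And>u a b. \<lbrakk>u \<in> I; a \<in> I; b \<in> I; h * u = f * a + g * b\<rbrakk> \<Longrightarrow>
      \<exists>a\<in>I. \<exists>b\<in>I. u = f * a + g * b"
  shows False
proof -
  note loopless = complete_multipartite_loopless[OF G]
  have mem_I: "y \<in> I \<longleftrightarrow> (\<forall>i<k. specialize (V i) y = 0)" for y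
    using mem_edge_ideal_complete_multipartite_iff[OF G] \<open>k \<ge> 2\<close> by (simp add: I)
  have I_mult: "c * x \<in> I" if "x \<in> I" for c x
    using that by (simp_all add: mem_I specialize_mult)
  obtain p q where p: "p \<in> V 0" and q: "q \<in> V 1"
    using nonempty \<open>k \<ge> 2\<close> by (metis One_nat_def Suc_1 Suc_le_lessD all_not_in_conv less_Suc_eq_le less_le_trans zero_less_Suc)
  have disjoint: "V 1 \<inter> V 0 = {}"
    using G \<open>k \<ge> 2\<close> unfolding complete_multipartite_def disjoint_family_on_def by simp
  have pq: "{p, q} \<in> E" "p \<noteq> q"
    using complete_multipartite_edge_iff[OF G, of 0 p q] p q disjoint \<open>k \<ge> 2\<close> by auto
  define e where "e = monom p 1 + (monom q 1 :: 'v \<Rightarrow>\<^sub>0 nat)"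
  define w where "w = (monom e 1 :: ('v, 'k) mpoly)"
  have "w \<in> I"
    using pq unfolding I mem_edge_ideal_iff[OF loopless] by (auto simp: w_def e_def support_add)
  have "w \<noteq> 0"
    unfolding w_def by (metis lookup_single_eq lookup_zero zero_neq_one)
  have "f \<noteq> 0"
    using f_regular[OF \<open>w \<in> I\<close>] \<open>w \<noteq> 0\<close> by auto
  have not_in_kernel: "specialize A f \<noteq> 0 \<or> specialize A g \<noteq> 0" if "\<And>j. j \<notin> A \<Longrightarrow> {x, j} \<in> E" for A x
    by (rule regular_pair_not_in_kernel[where E = E and p = x])
      (use loopless g_regular \<open>f \<noteq> 0\<close> that in \<open>auto simp: I\<close>)
  \<comment> \<open>The obstruction is \<open>u = f \<rho>(g) - g \<rho>(f)\<close>, which \<open>h\<close> multiplies into \<open>(f, g) I\<close>.\<close>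
  define \<rho> where "\<rho> = (specialize (V 0) :: ('v, 'k) mpoly \<Rightarrow> _)"
  have commutator: "x * \<rho> y - y * \<rho> x \<in> I" if "x \<in> irrelevant_ideal" "y \<in> irrelevant_ideal" for x y
    using commutator_mem_edge_ideal[OF G _ that, of 0] \<open>k \<ge> 2\<close> by (simp add: \<rho>_def I)
  have "- (h * \<rho> f - f * \<rho> h) \<in> I"
    using I_mult[OF commutator, of h f "-1"] irrelevant by simp
  moreover have "h * (f * \<rho> g - g * \<rho> f) = f * (h * \<rho> g - g * \<rho> h) + g * - (h * \<rho> f - f * \<rho> h)"
    by (simp add: algebra_simps)
  ultimately obtain a b where ab: "a \<in> I" "b \<in> I" "f * \<rho> g - g * \<rho> f = f * a + g * b"
    using h_regular[OF commutator commutator] irrelevant by meson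
  define s where "s = \<rho> g - a"
  define t where "t = \<rho> f + b"
  have st: "g * t = f * s"
    using ab(3) by (simp add: s_def t_def algebra_simps)
  \<comment> \<open>The next steps construct \<open>r = t / f = s / g\<close>. Multiplication by \<open>w\<close> moves \<open>t\<close> and \<open>s\<close>
    into \<open>I\<close>, where regularity provides \<open>c = w r\<close>; both variables in \<open>w\<close> then divide \<open>c\<close>
    because neither divides both \<open>f\<close> and \<open>g\<close>.\<close>
  have "g * (t * w) = f * (s * w)"
    using st by (metis mult.assoc)
  then obtain c where c: "c \<in> I" "t * w = f * c"
    using g_regular I_mult[OF \<open>w \<in> I\<close>] by blast
  have "f * (s * w) = g * (t * w)"
    by (simp add: st flip: mult.assoc)
  also have "\<dots> = f * (g * c)"
    unfolding c(2) by (rule mult.left_commute)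
  finally have sw: "s * w = g * c"
    unfolding mpoly_mult_left_cancel[OF \<open>f \<noteq> 0\<close>] .
  have c_vanishes: "specialize (- {y}) c = 0" if "x \<in> {p, q}" "y \<in> {p, q}" "x \<noteq> y" for x y
  proof -
    have "\<forall>j. j \<notin> - {y} \<longrightarrow> {x, j} \<in> E"
      using that \<open>x \<in> {p, q}\<close> \<open>y \<in> {p, q}\<close> \<open>x \<noteq> y\<close> pq by (auto simp: insert_commute)
    then have "specialize (- {y}) f \<noteq> 0 \<or> specialize (- {y}) g \<noteq> 0"
      using not_in_kernel by blast
    moreover have "specialize (- {y}) w = 0"
      using that(2) by (auto simp: specialize_eq_0_iff w_def e_def support_add)
    then have "specialize (- {y}) (f * c) = 0" "specialize (- {y}) (g * c) = 0"
      by (simp_all add: specialize_mult flip: c(2) sw)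
    ultimately show ?thesis
      by (auto simp: specialize_mult mpoly_mult_eq_0_iff)
  qed
  have "\<exists>m'. m = e + m'" if "m \<in> monomials c" for m
    using c_vanishes[of p q] c_vanishes[of q p] pq(2) that monom_factor_vars[of p q m]
    by (auto simp: specialize_eq_0_iff e_def)
  then obtain r where r: "c = w * r"
    using monomial_factor[of c e] unfolding w_def by metis
  have "w * t = w * (f * r)" "w * s = w * (g * r)"
    using c(2) sw r by (simp_all add: mult_ac)
  then have tr: "t = f * r" and sr: "s = g * r"
    unfolding mpoly_mult_left_cancel[OF \<open>w \<noteq> 0\<close>] .
  \<comment> \<open>Restricting \<open>t = f r\<close> and \<open>s = g r\<close> to the first two parts determines \<open>r\<close> there.\<close>
  have kill: "specialize (V i) a = 0" "specialize (V i) b = 0" if "i < k" for i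
    using ab that \<open>k \<ge> 2\<close> by (simp_all add: mem_I)
  have complement: "specialize (V i) f \<noteq> 0 \<or> specialize (V i) g \<noteq> 0" if "i < k" "x \<in> V i" for i x
    using not_in_kernel complete_multipartite_edge_iff[OF G that] by blast
  have "specialize (V 0) s = specialize (V 0) g" "specialize (V 0) t = specialize (V 0) f"
    using kill[of 0] \<open>k \<ge> 2\<close>
    by (simp_all add: s_def t_def \<rho>_def specialize_diff specialize_add specialize_specialize)
  then have "specialize (V 0) f * specialize (V 0) r = specialize (V 0) f * 1"
      "specialize (V 0) g * specialize (V 0) r = specialize (V 0) g * 1"
    by (simp_all add: tr sr specialize_mult)
  then have r0: "specialize (V 0) r = 1"
    using complement[of 0 p] p \<open>k \<ge> 2\<close> by (metis mpoly_mult_left_cancel not_numeral_le_zero not_gr_zero)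
  have "specialize (V 1) s = 0" "specialize (V 1) t = 0"
    using kill[of 1] \<open>k \<ge> 2\<close>
    by (simp_all add: s_def t_def \<rho>_def specialize_diff specialize_add specialize_specialize disjoint[simplified]
        specialize_irrelevant irrelevant)
  then have r1: "specialize (V 1) r = 0"
    using complement[OF _ q] \<open>k \<ge> 2\<close> by (auto simp: tr sr specialize_mult mpoly_mult_eq_0_iff)
  \<comment> \<open>The constant term of \<open>r\<close> would have to be both \<open>1\<close> and \<open>0\<close>.\<close>
  have "specialize {} r = specialize {} (specialize (V 0) r)"
    by (simp add: specialize_specialize)
  also have "\<dots> \<noteq> 0"
    by (simp add: r0 specialize_eq_0_iff)
  finally have "specialize {} (specialize (V 1) r) \<noteq> 0"
    by (simp add: specialize_specialize)
  then show False
    unfolding r1 by simp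
qed

lemma depth_edge_ideal_complete_multipartite_le:
  assumes G: "complete_multipartite UNIV E k V" and "k \<ge> 2" and "\<forall>i<k. V i \<noteq> {}"
  shows "depth (*) irrelevant_ideal (edge_ideal E :: ('v::finite, 'k::field) mpoly set) \<le> 2"
  unfolding depth_def
proof (rule Sup_least, clarify)
  fix fs :: "('v, 'k) mpoly list"
  let ?I = "edge_ideal E :: ('v, 'k) mpoly set"
  assume fs: "set fs \<subseteq> irrelevant_ideal" and reg: "regular_sequence (*) ?I fs"
  have I: "module.subspace (*) ?I"
    unfolding edge_ideal_def by (rule subspace_ideal_generated)
  have "length fs \<le> 2"
  proof (rule ccontr)
    assume "\<not> length fs \<le> 2"
    then obtain f g h gs where fs_eq: "fs = f # g # h # gs"
      by (auto simp: not_le numeral_2_eq_2 Suc_less_eq2 length_Suc_conv dest!: Suc_leI simp: Suc_le_length_iff)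
    have step: "u \<in> ideal_times_module (*) (set (take i fs)) ?I"
      if "i < length fs" "u \<in> ?I" "(fs ! i) * u \<in> ideal_times_module (*) (set (take i fs)) ?I" for i u
      using reg that unfolding regular_sequence_def by blast
    have itm1: "ideal_times_module (*) {f} ?I = {f * c | c. c \<in> ?I}"
      by (simp add: ideal_times_module_insert[OF I] ideal_times_module_empty)
    have itm2: "ideal_times_module (*) {f, g} ?I = {f * a + g * b | a b. a \<in> ?I \<and> b \<in> ?I}"
      unfolding ideal_times_module_insert[OF I, of f "{g}"]
      by (auto simp: ideal_times_module_insert[OF I] ideal_times_module_empty)
    show False
    proof (rule no_regular_triple[OF G \<open>k \<ge> 2\<close> assms(3) refl])
      show "f \<in> irrelevant_ideal" "g \<in> irrelevant_ideal" "h \<in> irrelevant_ideal"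
        using fs by (auto simp: fs_eq)
      show "u = 0" if "u \<in> ?I" "f * u = 0" for u
        using step[of 0 u] that by (simp add: fs_eq ideal_times_module_empty)
      show "\<exists>d\<in>?I. u = f * d" if "u \<in> ?I" "c \<in> ?I" "g * u = f * c" for u c
        using step[of 1 u] that by (auto simp: fs_eq itm1)
      show "\<exists>a\<in>?I. \<exists>b\<in>?I. u = f * a + g * b"
        if "u \<in> ?I" "a \<in> ?I" "b \<in> ?I" "h * u = f * a + g * b" for u a b
        using step[of 2 u] that by (auto simp: fs_eq itm2 numeral_2_eq_2)
    qed
  qed
  then show "enat (length fs) \<le> 2"
    by (simp add: numeral_eq_enat)
qed

section \<open>A Stanley decomposition\<close>

text \<open>A classification of the monomials splits every polynomial uniquely into the parts supported on
  the single classes.\<close>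

lemma is_direct_sum_by_monomials:
  fixes cs :: "'c list" and cls :: "'a \<Rightarrow> 'c"
  defines "U \<equiv> \<lambda>i. {f :: 'a \<Rightarrow>\<^sub>0 'b::ab_group_add. \<forall>m\<in>monomials f. cls m = cs ! i}"
  assumes "distinct cs"
  shows "is_direct_sum {f. \<forall>m\<in>monomials f. cls m \<in> set cs} (length cs) U"
  unfolding is_direct_sum_def
proof (rule bij_betw_byWitness)
  let ?n = "length cs"
  let ?split = "\<lambda>f. \<lambda>i\<in>{..<?n}. restrict_monomials (\<lambda>m. cls m = cs ! i) f"
  let ?M = "{f :: 'a \<Rightarrow>\<^sub>0 'b. \<forall>m\<in>monomials f. cls m \<in> set cs}"
  have index: "i = j" if "i < ?n" "j < ?n" "cs ! i = cs ! j" for i j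
    using that \<open>distinct cs\<close> by (simp add: nth_eq_iff_index_eq)
  show "\<forall>x\<in>\<Pi>\<^sub>E i\<in>{..<?n}. U i. ?split (\<Sum>i<?n. x i) = x"
  proof
    fix x assume x: "x \<in> (\<Pi>\<^sub>E i\<in>{..<?n}. U i)"
    then have vanish: "coefficient (x j) m = 0" if "j < ?n" "cls m \<noteq> cs ! j" for j m
      using that unfolding U_def PiE_iff by (metis (mono_tags, lifting) in_keys_iff lessThan_iff mem_Collect_eq)
    have "restrict_monomials (\<lambda>m. cls m = cs ! i) (\<Sum>j<?n. x j) = x i" if i: "i < ?n" for i
    proof (rule poly_mapping_eqI)
      fix m
      have "(\<Sum>j<?n. coefficient (x j) m) = (\<Sum>j<?n. if j = i then coefficient (x i) m else 0)"
        if "cls m = cs ! i"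
        proof (rule sum.cong)
        fix j assume "j \<in> {..<?n}"
        then show "coefficient (x j) m = (if j = i then coefficient (x i) m else 0)"
          using vanish[of j m] index[of j i] i that by (metis lessThan_iff)
      qed simp
      then show "coefficient (restrict_monomials (\<lambda>m. cls m = cs ! i) (\<Sum>j<?n. x j)) m = coefficient (x i) m"
        using i vanish by (auto simp: lookup_sum)
    qed
    then show "?split (\<Sum>i<?n. x i) = x"
      using x by (intro ext) (auto simp: PiE_iff extensional_def)
  qed
  show "\<forall>f\<in>?M. (\<Sum>i<?n. ?split f i) = f"
  proof
    fix f assume f: "f \<in> ?M"
    show "(\<Sum>i<?n. ?split f i) = f"
    proof (rule poly_mapping_eqI)
      fix m
      show "coefficient (\<Sum>i<?n. ?split f i) m = coefficient f m"
      proof (cases "m \<in> monomials f")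
        case True
        then obtain j where j: "j < ?n" "cls m = cs ! j"
          using f by (auto simp: in_set_conv_nth)
        then have "(\<Sum>i<?n. coefficient (?split f i) m) = (\<Sum>i<?n. if i = j then coefficient f m else 0)"
          using index by (intro sum.cong) auto
        then show ?thesis
          using j by (simp add: lookup_sum)
      next
        case False
        then show ?thesis
          by (auto simp: lookup_sum in_keys_iff intro!: sum.neutral)
      qed
    qed
  qed
  show "(\<lambda>x. \<Sum>i<?n. x i) ` (\<Pi>\<^sub>E i\<in>{..<?n}. U i) \<subseteq> ?M"
  proof clarify
    fix x m assume x: "x \<in> (\<Pi>\<^sub>E i\<in>{..<?n}. U i)" and "m \<in> monomials (\<Sum>i<?n. x i)"
    then obtain i where "i < ?n" "m \<in> monomials (x i)"
      using keys_sum[of x "{..<?n}"] by blast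
    then show "cls m \<in> set cs"
      using x unfolding U_def PiE_iff by auto
  qed
  show "?split ` ?M \<subseteq> (\<Pi>\<^sub>E i\<in>{..<?n}. U i)"
    unfolding U_def image_subset_iff restrict_PiE_iff by simp
qed

definition squarefree_exponent :: "'v::finite set \<Rightarrow> 'v \<Rightarrow>\<^sub>0 nat" where
  "squarefree_exponent A = (\<Sum>v\<in>A. monom v 1)"

definition squarefree_monom :: "'v::finite set \<Rightarrow> ('v, 'k::comm_ring_1) mpoly" where
  "squarefree_monom A = monom (squarefree_exponent A) 1"

lemma coefficient_squarefree_exponent [simp]:
  "coefficient (squarefree_exponent A) v = (if v \<in> A then 1 else 0)"
  by (simp add: squarefree_exponent_def lookup_sum lookup_single when_def)

lemma support_squarefree_exponent [simp]: "support (squarefree_exponent A) = A"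
  by (auto simp: in_keys_iff split: if_splits)

text \<open>The monomials with support \<open>A\<close> are the multiples of \<open>x\<^sub>A\<close> by monomials in the variables
  from \<open>A\<close>. The Stanley spaces \<open>x\<^sub>A K[A]\<close> thus correspond to the classification of monomials by
  support.\<close>

lemma stanley_space_squarefree_monom:
  fixes A :: "'v::finite set"
  shows "stanley_space (*) (squarefree_monom A :: ('v, 'k::comm_ring_1) mpoly) A =
    {f. \<forall>m\<in>monomials f. support m = A}"
proof
  let ?e = "squarefree_exponent A"
  show "stanley_space (*) (squarefree_monom A) A \<subseteq> {f :: ('v, 'k) mpoly. \<forall>m\<in>monomials f. support m = A}"
    unfolding stanley_space_def polys_in_def squarefree_monom_def
    by (auto simp: support_add elim!: monomials_mult_cases split: if_splits, blast)
  show "{f :: ('v, 'k) mpoly. \<forall>m\<in>monomials f. support m = A} \<subseteq> stanley_space (*) (squarefree_monom A) A"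
  proof clarify
    fix f :: "('v, 'k) mpoly" assume f: "\<forall>m\<in>monomials f. support m = A"
    have "m = ?e + (m - ?e)" if "m \<in> monomials f" for m
    proof (rule poly_mapping_eqI)
      fix v
      have "coefficient m v = 0 \<longleftrightarrow> v \<notin> A"
        using f that by (auto simp: in_keys_iff)
      then show "coefficient m v = coefficient (?e + (m - ?e)) v"
        by (auto simp: lookup_add lookup_minus)
    qed
    then obtain q where q: "f = monom ?e 1 * q" "\<And>m. m \<in> monomials q \<Longrightarrow> ?e + m \<in> monomials f"
      using monomial_factor[of f ?e] by metis
    have "support m \<subseteq> A" if "m \<in> monomials q" for m
      using bspec[OF f q(2)[OF that]] by (auto simp: support_add)
    then have "q \<in> polys_in A"
      by (simp add: polys_in_def)
    moreover have "f = q * squarefree_monom A"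
      unfolding squarefree_monom_def q(1) by (rule mult.commute)
    ultimately show "f \<in> stanley_space (*) (squarefree_monom A) A"
      unfolding stanley_space_def by blast
  qed
qed

text \<open>The maximum over decompositions is attained since no Stanley space has dimension above the number
  of variables. The condition \<open>M \<noteq> {0}\<close> excludes the empty decomposition, for which the minimum of
  the dimensions is unspecified.\<close>

lemma sdepth_ge:
  fixes D :: "(('v::finite, 'k::comm_ring_1) mpoly \<times> 'v set) list"
  assumes "stanley_decomposition (*) mpoly_component M D" and "M \<noteq> {0}"
    and "\<And>u Z. (u, Z) \<in> set D \<Longrightarrow> d \<le> card Z"
  shows "d \<le> sdepth (*) mpoly_component M"
proof -
  have nonempty: "D' \<noteq> []" if "stanley_decomposition (*) mpoly_component M D'" for D'
    using that \<open>M \<noteq> {0}\<close> unfolding stanley_decomposition_def is_direct_sum_def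
    by (auto simp: bij_betw_def)
  have bounded: "sdepth_decomposition D' \<le> card (UNIV :: 'v set)" if D': "stanley_decomposition (*) mpoly_component M D'" for D'
  proof -
    obtain u Z where "(u, Z) \<in> set D'"
      using nonempty[OF D'] by (metis list.set_intros(1) neq_Nil_conv surj_pair)
    then have "sdepth_decomposition D' \<le> card Z"
      unfolding sdepth_decomposition_def by (intro Min_le) force+
    also have "\<dots> \<le> card (UNIV :: 'v set)"
      by (rule card_mono) auto
    finally show ?thesis .
  qed
  have "d \<le> sdepth_decomposition D"
    unfolding sdepth_decomposition_def using nonempty[OF assms(1)] assms(3) by (subst Min_ge_iff) auto
  also have "\<dots> \<le> sdepth (*) mpoly_component M"
    unfolding sdepth_def
  proof (rule Max_ge)
    show "finite {sdepth_decomposition D |D. stanley_decomposition (*) mpoly_component M D}"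
      by (rule finite_subset[of _ "{..card (UNIV :: 'v set)}"]) (use bounded in auto)
  qed (use assms(1) in blast)
  finally show ?thesis .
qed

text \<open>The spaces of the decomposition have dimension \<open>card A\<close>, and \<open>A\<close> contains two adjacent
  vertices.\<close>

lemma sdepth_edge_ideal_ge:
  assumes loopless: "\<And>v. {v} \<notin> E" and "{p, q} \<in> E"
  shows "2 \<le> sdepth (*) mpoly_component (edge_ideal E :: ('v::finite, 'k::field) mpoly set)"
proof -
  let ?I = "edge_ideal E :: ('v, 'k) mpoly set"
  let ?F = "{A. \<exists>u v. {u, v} \<in> E \<and> u \<in> A \<and> v \<in> A}"
  have "finite ?F" by simp
  then obtain As where As: "set As = ?F" "distinct As"
    using finite_distinct_list[of ?F] by metis
  define D where "D = map (\<lambda>A. (squarefree_monom A :: ('v, 'k) mpoly, A)) As"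
  have I: "?I = {f. \<forall>m\<in>monomials f. support m \<in> set As}"
    by (auto simp: As mem_edge_ideal_iff[OF loopless])
  have nonzero: "(squarefree_monom A :: ('v, 'k) mpoly) \<noteq> 0" for A
    unfolding squarefree_monom_def by (metis lookup_single_eq lookup_zero zero_neq_one)
  have mem: "squarefree_monom A \<in> ?I" if "A \<in> ?F" for A
  proof -
    have "squarefree_monom A \<in> stanley_space (*) (squarefree_monom A :: ('v, 'k) mpoly) A"
      unfolding stanley_space_def polys_in_def by (rule image_eqI[of _ _ 1]) auto
    then show ?thesis
      using that unfolding stanley_space_squarefree_monom I As by blast
  qed
  have homogeneous: "squarefree_monom A \<in> (mpoly_component (\<lambda>v. if v \<in> A then 1 else 0) :: ('v, 'k) mpoly set)" for A
    by (auto simp: squarefree_monom_def mpoly_component_def)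
  have "is_direct_sum ?I (length D) (\<lambda>i. {f. \<forall>m\<in>monomials f. support m = As ! i})"
    unfolding I D_def length_map by (rule is_direct_sum_by_monomials[OF As(2)])
  also have "is_direct_sum ?I (length D) (\<lambda>i. {f. \<forall>m\<in>monomials f. support m = As ! i}) \<longleftrightarrow>
      is_direct_sum ?I (length D) (\<lambda>i. stanley_space (*) (fst (D ! i)) (snd (D ! i)))"
    unfolding is_direct_sum_def
    by (intro arg_cong[of _ _ "\<lambda>X. bij_betw _ X _"] PiE_cong) (simp add: D_def stanley_space_squarefree_monom)
  finally have "stanley_decomposition (*) mpoly_component ?I D"
    using mem homogeneous unfolding stanley_decomposition_def is_stanley_space_def
    by (auto simp: D_def As mpoly_mult_eq_0_iff nonzero)
  moreover have "?I \<noteq> {0}"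
    using mem[of UNIV] \<open>{p, q} \<in> E\<close> nonzero by blast
  moreover have "2 \<le> card Z" if "(u, Z) \<in> set D" for u Z
  proof -
    have "Z \<in> ?F"
      using that by (auto simp: D_def As)
    then obtain x y where "{x, y} \<in> E" "{x, y} \<subseteq> Z"
      by blast
    then show ?thesis
      using loopless[of x] card_mono[of Z "{x, y}"] by (cases "x = y") auto
  qed
  ultimately show ?thesis
    by (rule sdepth_ge)
qed

theorem corollary2p8:
  fixes k :: nat
    and V :: "nat \<Rightarrow> 'v::finite set"
    and E :: "'v set set"
    and I :: "('v, 'k::field) mpoly set"
  assumes "k \<ge> 2"
    and "complete_multipartite UNIV E k V"
    and "\<forall>i<k. V i \<noteq> {}"
    and "I = edge_ideal E"
  shows "enat (sdepth (*) mpoly_component I) \<ge> depth (*) irrelevant_ideal I"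
proof -
  have "0 < k" "1 < k" using \<open>k \<ge> 2\<close> by auto
  then obtain p q where pq: "p \<in> V 0" "q \<in> V 1"
    using assms(3) by blast
  have "{p, q} \<in> E"
  proof -
    have "q \<notin> V 0"
      using assms(2) pq \<open>0 < k\<close> \<open>1 < k\<close>
      unfolding complete_multipartite_def disjoint_family_on_def by fastforce
    then show ?thesis
      using complete_multipartite_edge_iff[OF assms(2) \<open>0 < k\<close> pq(1)] by blast
  qed
  then have "2 \<le> sdepth (*) mpoly_component I"
    using sdepth_edge_ideal_ge[OF complete_multipartite_loopless[OF assms(2)]] assms(4) by blast
  moreover have "depth (*) irrelevant_ideal I \<le> 2"
    using depth_edge_ideal_complete_multipartite_le[OF assms(2,1,3)] assms(4) by simp
  ultimately show ?thesis
    by (metis enat_ord_simps(1) numeral_eq_enat order_trans)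
qed

end
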